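(* For every integer $m\ge 3$, \[ \gamma_{oiR}(P_{3}\Box C_{m})=\begin{cases}2m, & m\equiv 0 \pmod 2,\\ 2m+1, & m\equiv 1 \pmod 2.\end{cases} \]
   Context: All graphs are simple and undirected. $P_n$ denotes the path on $n$ vertices and $C_m$ the cycle on $m$ vertices; $P_n\Box C_m$ is their Cartesian product, with vertex set $\{v_{i,j}: 0\le i\le n-1,\ 0\le j\le m-1\}$, where $v_{i,j}$ and $v_{i',j'}$ are adjacent iff either $i=i'$ and $j'\equiv j\pm1 \pmod m$, or $j=j'$ and $|i-i'|=1$. For a graph $G=(V,E)$, an outer independent Roman dominating function (OIRDF) is a function $f:V\to\{0,1,2\}$ such that every vertex $u$ with $f(u)=0$ has a neighbour $v$ with $f(v)=2$, and the set $V_0=\{u\in V: f(u)=0\}$ is an independent set. The weight of $f$ is $w(f)=\sum_{v\in V}f(v)$, and $\gamma_{oiR}(G)$ is the minimum weight of an OIRDF of $G$. *)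

theory Defs
  imports "Graph_Theory.Graph_Theory" "HOL-Number_Theory.Cong"
begin

text \<open>
  A finite simple undirected graph is a \<^locale>\<open>pair_graph\<close>: each edge \<open>uv\<close> is represented
  by the two arcs \<open>(u, v)\<close> and \<open>(v, u)\<close>.
\<close>

definition path_graph :: "nat \<Rightarrow> nat pair_pre_digraph" where
  "path_graph n = \<lparr> pverts = {..<n},
     parcs = {(i, i'). i < n \<and> i' < n \<and> (i' = i + 1 \<or> i = i' + 1)} \<rparr>"

text \<open>For \<open>m \<le> 2\<close> the following is not a cycle (for \<open>m = 1\<close> it has a loop).\<close>

definition cycle_graph :: "nat \<Rightarrow> nat pair_pre_digraph" where
  "cycle_graph m = \<lparr> pverts = {..<m},
     parcs = {(j, j'). j < m \<and> j' < m \<and> ([j' = j + 1] (mod m) \<or> [j = j' + 1] (mod m))} \<rparr>"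

definition cartesian_product ::
    "'a pair_pre_digraph \<Rightarrow> 'b pair_pre_digraph \<Rightarrow> ('a \<times> 'b) pair_pre_digraph" (infixl "\<box>" 70) where
  "G \<box> H = \<lparr> pverts = pverts G \<times> pverts H,
     parcs = {((u, v), (u', v')).
       u = u' \<and> u \<in> pverts G \<and> (v, v') \<in> parcs H \<or>
       v = v' \<and> v \<in> pverts H \<and> (u, u') \<in> parcs G} \<rparr>"

definition independent_set :: "'a pair_pre_digraph \<Rightarrow> 'a set \<Rightarrow> bool" where
  "independent_set G S \<longleftrightarrow> S \<subseteq> pverts G \<and> (\<forall>u\<in>S. \<forall>v\<in>S. (u, v) \<notin> parcs G)"

text \<open>Only the values of \<open>f\<close> on the vertex set matter in the next two definitions.\<close>

definition oirdf :: "'a pair_pre_digraph \<Rightarrow> ('a \<Rightarrow> nat) \<Rightarrow> bool" where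
  "oirdf G f \<longleftrightarrow>
     (\<forall>v\<in>pverts G. f v \<in> {0, 1, 2}) \<and>
     (\<forall>u\<in>pverts G. f u = 0 \<longrightarrow> (\<exists>v\<in>pverts G. (u, v) \<in> parcs G \<and> f v = 2)) \<and>
     independent_set G {u \<in> pverts G. f u = 0}"

definition weight :: "'a pair_pre_digraph \<Rightarrow> ('a \<Rightarrow> nat) \<Rightarrow> nat" where
  "weight G f = (\<Sum>v\<in>pverts G. f v)"

definition oir_domination_number :: "'a pair_pre_digraph \<Rightarrow> nat" ("\<gamma>\<^sub>o\<^sub>i\<^sub>R") where
  "\<gamma>\<^sub>o\<^sub>i\<^sub>R G = (LEAST w. \<exists>f. oirdf G f \<and> weight G f = w)"

lemma oirdf_const_1: "oirdf G (\<lambda>_. 1)"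
  by (simp add: oirdf_def independent_set_def)

lemma oir_domination_number_attained: "\<exists>f. oirdf G f \<and> weight G f = \<gamma>\<^sub>o\<^sub>i\<^sub>R G"
  unfolding oir_domination_number_def by (rule LeastI_ex) (use oirdf_const_1 in blast)

lemma oir_domination_number_le: "oirdf G f \<Longrightarrow> \<gamma>\<^sub>o\<^sub>i\<^sub>R G \<le> weight G f"
  unfolding oir_domination_number_def by (rule Least_le) blast

lemma pverts_path_cycle: "pverts (path_graph n \<box> cycle_graph m) = {..<n} \<times> {..<m}"
  by (simp add: cartesian_product_def path_graph_def cycle_graph_def)

lemma parcs_path_cycle:
  "((i, j), (i', j')) \<in> parcs (path_graph n \<box> cycle_graph m) \<longleftrightarrow>
     i < n \<and> i' < n \<and> j < m \<and> j' < m \<and>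
     (i = i' \<and> ([j' = j + 1] (mod m) \<or> [j = j' + 1] (mod m)) \<or>
      j = j' \<and> (i' = i + 1 \<or> i = i' + 1))"
  by (auto simp: cartesian_product_def path_graph_def cycle_graph_def)

lemma pair_graph_path_cycle:
  assumes "m \<ge> 2"
  shows "pair_graph (path_graph n \<box> cycle_graph m)"
proof -
  let ?G = "path_graph n \<box> cycle_graph m"
  have sub: "parcs ?G \<subseteq> pverts ?G \<times> pverts ?G"
    by (auto simp: pverts_path_cycle parcs_path_cycle)
  have fin: "finite (pverts ?G)"
    by (simp add: pverts_path_cycle)
  have loopfree: "(v, v) \<notin> parcs ?G" for v
  proof -
    have "\<not> [j = j + 1] (mod m)" if "j < m" for j
      using that assms by (cases "j + 1 = m") (auto simp: cong_def)
    then show ?thesis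
      by (cases v) (auto simp: parcs_path_cycle)
  qed
  have "sym (parcs ?G)"
    by (auto simp: sym_def parcs_path_cycle)
  then have "symmetric (with_proj ?G)"
    by (simp add: symmetric_def)
  moreover have "finite (parcs ?G)"
    using sub fin by (meson finite_SigmaI finite_subset)
  moreover have "fst e \<noteq> snd e" if "e \<in> parcs ?G" for e
    using that loopfree[of "fst e"] by (cases e) auto
  moreover have "fst e \<in> pverts ?G" "snd e \<in> pverts ?G" if "e \<in> parcs ?G" for e
    using that sub by (auto simp: mem_Times_iff)
  ultimately show ?thesis
    using fin by unfold_locales blast+
qed

end

theory Submission
  imports Defs
begin

text \<open>
  The upper bound comes from alternating the columns \<open>(0,2,0)\<close> and \<open>(1,0,1)\<close>, closing up with
  \<open>(1,1,1)\<close> if \<open>m\<close> is odd.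

  The lower bound is a discharging argument on the column weights, whose target average is \<open>2\<close>.
  The only columns of weight below \<open>2\<close> are of the form \<open>(0,1,0)\<close>; the zeros there are dominated
  horizontally, so such a column has either a neighbour of weight at least \<open>4\<close> or two neighbours of
  weight at least \<open>3\<close>. Let a column of weight \<open>3\<close> give \<open>1/2\<close>, and a column of weight at least \<open>4\<close>
  give \<open>1\<close>, to each neighbour of weight \<open>1\<close>; then all columns end with at least \<open>2\<close>. If all of
  them end with exactly \<open>2\<close>, then the zeros of the top row occur in every second column, which
  forces \<open>m\<close> to be even.
\<close>

section \<open>Discharging on columns, with the cycle unrolled to \<open>m\<close>-periodic rows
  over \<open>nat\<close>\<close>

locale oird_columns =
  fixes a b c :: "nat \<Rightarrow> nat" and m :: nat
  assumes indep_row: "a j \<noteq> 0 \<or> a (j + 1) \<noteq> 0" "b j \<noteq> 0 \<or> b (j + 1) \<noteq> 0" "c j \<noteq> 0 \<or> c (j + 1) \<noteq> 0"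
    and indep_col: "a j \<noteq> 0 \<or> b j \<noteq> 0" "b j \<noteq> 0 \<or> c j \<noteq> 0"
    and dom_a: "a (j + 1) = 0 \<Longrightarrow> a j = 2 \<or> a (j + 2) = 2 \<or> b (j + 1) = 2"
    and dom_c: "c (j + 1) = 0 \<Longrightarrow> c j = 2 \<or> c (j + 2) = 2 \<or> b (j + 1) = 2"
    and periodic: "a (j + m) = a j" "b (j + m) = b j" "c (j + m) = c j"
begin

definition w :: "nat \<Rightarrow> nat" where
  "w j = a j + b j + c j"

definition gift :: "nat \<Rightarrow> int" where
  "gift x = (if x \<ge> 4 then 2 else if x = 3 then 1 else 0)"

text \<open>The net charge sent from column \<open>j\<close> to column \<open>j + 1\<close>, in units of \<open>1/2\<close>.\<close>

definition flow :: "nat \<Rightarrow> int" where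
  "flow j = (if w (j + 1) = 1 then gift (w j) else 0) - (if w j = 1 then gift (w (j + 1)) else 0)"

text \<open>Twice the final weight of column \<open>j + 1\<close>, so the target becomes 4 and
  everything stays integral; the shift avoids predecessors in \<open>nat\<close>.\<close>

definition charge :: "nat \<Rightarrow> int" where
  "charge j = 2 * int (w (j + 1)) + flow j - flow (j + 1)"

lemma w_pos: "w j \<ge> 1"
  using indep_col[of j] by (auto simp: w_def)

lemma w_eq_1D:
  assumes "w j = 1"
  shows "a j = 0" "b j = 1" "c j = 0"
  using assms indep_col[of j] by (auto simp: w_def)

text \<open>Each outer zero needs a horizontal 2, the middle entry being 1. If both 2s lie in one
  column, it weighs at least 4; otherwise each side has a 2 and, by independence, a further positive
  outer entry.\<close>

lemma w_eq_1_neighbours: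
  assumes "w (j + 1) = 1"
  shows "w j \<ge> 2" "w (j + 2) \<ge> 2" "w j \<ge> 4 \<or> w (j + 2) \<ge> 4 \<or> w j \<ge> 3 \<and> w (j + 2) \<ge> 3"
proof -
  note zero = w_eq_1D[OF assms]
  have pos: "a j \<ge> 1" "c j \<ge> 1" "a (j + 2) \<ge> 1" "c (j + 2) \<ge> 1"
    using indep_row[of j] indep_row[of "j + 1"] zero by (auto simp: numeral_2_eq_2)
  then show "w j \<ge> 2" "w (j + 2) \<ge> 2"
    by (auto simp: w_def)
  have "a j = 2 \<or> a (j + 2) = 2" "c j = 2 \<or> c (j + 2) = 2"
    using dom_a[of j] dom_c[of j] zero by auto
  with pos show "w j \<ge> 4 \<or> w (j + 2) \<ge> 4 \<or> w j \<ge> 3 \<and> w (j + 2) \<ge> 3"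
    unfolding w_def by linarith
qed

lemma charge_ge: "charge j \<ge> 4"
  using w_eq_1_neighbours[of j] w_pos[of "j + 1"]
  by (auto simp: charge_def flow_def gift_def numeral_2_eq_2)

text \<open>A column of weight at least 3 gets rid of its whole surplus only by giving to both
  sides.\<close>

lemma charge_eq_4D:
  assumes "charge j = 4" "w (j + 1) \<ge> 3"
  shows "w j = 1" "w (j + 2) = 1"
  using assms
  by (auto simp: charge_def flow_def gift_def numeral_2_eq_2 split: if_splits) presburger+

lemma sum_shift: "(\<Sum>j<m. w (j + 1)) = (\<Sum>j<m. w j)"
proof -
  have "w 0 = w m"
    using periodic[of 0] by (simp add: w_def)
  then show ?thesis
    using sum.lessThan_Suc_shift[of w m] sum.lessThan_Suc[of w m] by simp
qed

lemma sum_charge: "(\<Sum>j<m. charge j) = 2 * int (\<Sum>j<m. w j)"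
proof -
  have "w (m + k) = w k" for k
    using periodic[of k] by (simp add: w_def add.commute)
  from this[of 0] this[of 1] have "flow m = flow 0"
    by (simp add: flow_def)
  \<comment> \<open>Discharging preserves the total: the flow telescopes around the cycle.\<close>
  then have "(\<Sum>j<m. flow j - flow (j + 1)) = 0"
    using sum_lessThan_telescope'[of flow m] by simp
  then have "(\<Sum>j<m. charge j) = 2 * int (\<Sum>j<m. w (j + 1))"
    by (simp add: charge_def add_diff_eq[symmetric] sum.distrib sum_distrib_left)
  then show ?thesis
    by (simp only: sum_shift)
qed

lemma sum_w_ge: "(\<Sum>j<m. w j) \<ge> 2 * m"
proof -
  have "(\<Sum>j<m. 4) \<le> (\<Sum>j<m. charge j)"
    by (rule sum_mono) (rule charge_ge)
  then show ?thesis
    by (simp add: sum_charge flip: of_nat_sum)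
qed

lemma charge_periodic: "charge (j + m) = charge j"
proof -
  have w: "w (j + m) = w j" for j
    using periodic[of j] by (simp add: w_def)
  show ?thesis
    using w[of j] w[of "j + 1"] w[of "j + 2"]
    by (simp add: charge_def flow_def add.commute add.left_commute)
qed

lemma charge_eq_4:
  assumes "(\<Sum>j<m. w j) = 2 * m" "m > 0"
  shows "charge j = 4"
proof -
  have "(\<Sum>j<m. charge j - 4) = 0"
    using assms(1) by (simp add: sum_charge sum_subtractf flip: of_nat_sum)
  then have 0: "charge j = 4" if "j < m" for j
    using that charge_ge by (subst (asm) sum_nonneg_eq_0_iff) auto
  have "charge (k * m + j) = charge j" for k j
    by (induction k) (use charge_periodic in \<open>simp_all add: ac_simps, metis add.assoc add.commute\<close>)
  from this[of "j div m" "j mod m"] 0[of "j mod m"] assms(2) show ?thesis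
    by simp
qed

lemma even_if_tight:
  assumes "(\<Sum>j<m. w j) = 2 * m" "m > 0"
  shows "even m"
proof -
  have heavy: "w j = 1 \<and> w (j + 2) = 1" if "w (j + 1) \<ge> 3" for j
    using charge_eq_4D[OF charge_eq_4[OF assms] that] by blast
  have w_ge_3: "w k \<ge> 3" if "c k = 2" for k
    using that indep_col[of k] by (auto simp: w_def)
  \<comment> \<open>Otherwise the column is \<open>(1,1,0)\<close>, whose zero needs a horizontal 2.
    That 2 lies in a heavy column, which has only neighbours of weight 1.\<close>
  have outer: "c (j + 2) \<noteq> 0" if "w (j + 2) = 2" "a (j + 2) \<noteq> 0" for j
  proof
    assume c: "c (j + 2) = 0"
    with that indep_col[of "j + 2"] have "b (j + 2) = 1"
      by (auto simp: w_def)
    with c dom_c[of "j + 1"] have "c (j + 1) = 2 \<or> c (j + 3) = 2"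
      by (auto simp: numeral_2_eq_2 numeral_3_eq_3)
    with w_ge_3 heavy[of j] heavy[of "j + 2"] have "w (j + 2) = 1"
      by (auto simp: numeral_2_eq_2 numeral_3_eq_3)
    with that show False by simp
  qed
  have alternate: "a (j + 3) = 0 \<longleftrightarrow> a (j + 2) \<noteq> 0" for j
  proof -
    \<comment> \<open>Both columns must have weight 2, hence both are \<open>(1,0,1)\<close>, and
      their middle zeros are adjacent.\<close>
    have False if "a (j + 2) \<noteq> 0" "a (j + 3) \<noteq> 0"
    proof -
      have "w (j + 2) \<noteq> 1" "w (j + 3) \<noteq> 1"
        using that w_eq_1D(1)[of "j + 2"] w_eq_1D(1)[of "j + 3"] by auto
      moreover have "w (j + 2) \<ge> 3 \<Longrightarrow> w (j + 3) = 1" "w (j + 3) \<ge> 3 \<Longrightarrow> w (j + 2) = 1"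
        using heavy[of "j + 1"] heavy[of "j + 2"] by (simp_all add: numeral_2_eq_2 numeral_3_eq_3)
      ultimately have w2: "w (j + 2) = 2" "w (j + 3) = 2"
        using w_pos[of "j + 2"] w_pos[of "j + 3"] by linarith+
      with that outer[of j] outer[of "j + 1"] have "c (j + 2) \<noteq> 0" "c (j + 3) \<noteq> 0"
        by (auto simp: numeral_2_eq_2 numeral_3_eq_3)
      with that w2 have "b (j + 2) = 0" "b (j + 3) = 0"
        by (auto simp: w_def)
      then show False
        using indep_row(2)[of "j + 2"] by (simp add: numeral_2_eq_2 numeral_3_eq_3)
    qed
    then show ?thesis
      using indep_row(1)[of "j + 2"] by (auto simp: numeral_2_eq_2 numeral_3_eq_3)
  qed
  have "a (k + 2) = 0 \<longleftrightarrow> (even k \<longleftrightarrow> a 2 = 0)" for k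
  proof (induction k)
    case (Suc k)
    have "Suc k + 2 = k + 3" by simp
    with Suc alternate[of k] show ?case
      by (metis even_Suc)
  qed (simp add: numeral_2_eq_2)
  \<comment> \<open>After one turn of \<open>m\<close> columns the alternation returns to its
    start.\<close>
  from this[of m] periodic(1)[of 2] show ?thesis
    by (auto simp: add.commute)
qed

end

section \<open>From dominating functions to periodic columns\<close>

lemma oirdf_independent:
  assumes "oirdf G f" "u \<in> pverts G" "v \<in> pverts G" "(u, v) \<in> parcs G"
  shows "f u \<noteq> 0 \<or> f v \<noteq> 0"
  using assms by (auto simp: oirdf_def independent_set_def)

lemma oird_columns_of_oirdf:
  assumes "oirdf (path_graph 3 \<box> cycle_graph m) f" "m > 0"
  shows "oird_columns (\<lambda>j. f (0, j mod m)) (\<lambda>j. f (1, j mod m)) (\<lambda>j. f (2, j mod m)) m"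
proof -
  let ?G = "path_graph 3 \<box> cycle_graph m"
  have indep: "f u \<noteq> 0 \<or> f v \<noteq> 0" if "(u, v) \<in> parcs ?G" for u v
  proof -
    have "u \<in> pverts ?G" "v \<in> pverts ?G"
      using that by (cases u; cases v; simp add: pverts_path_cycle parcs_path_cycle)+
    with oirdf_independent[OF assms(1)] that show ?thesis
      by simp
  qed
  have row: "((i, j mod m), (i, (j + 1) mod m)) \<in> parcs ?G" if "i < 3" for i j
    using that assms by (simp add: parcs_path_cycle cong_def mod_simps)
  have col: "((i, j mod m), (i + 1, j mod m)) \<in> parcs ?G" if "i < 2" for i j
    using that assms by (simp add: parcs_path_cycle)
  have dom: "f (i, j mod m) = 2 \<or> f (i, (j + 2) mod m) = 2 \<or> f (1, (j + 1) mod m) = 2"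
    if "i = 0 \<or> i = 2" "f (i, (j + 1) mod m) = 0" for i j
  proof -
    let ?k = "(j + 1) mod m"
    have "(i, ?k) \<in> pverts ?G"
      using assms(2) that(1) by (auto simp: pverts_path_cycle)
    with assms(1) that(2) obtain v where "((i, ?k), v) \<in> parcs ?G" "f v = 2"
      unfolding oirdf_def by blast
    moreover obtain i' j' where "v = (i', j')" by force
    ultimately have v: "((i, ?k), (i', j')) \<in> parcs ?G" "f (i', j') = 2" by auto
    from v(1) have "j' < m"
      by (simp add: parcs_path_cycle)
    then have "j' = (j + 2) mod m" if "[j' = ?k + 1] (mod m)"
      using that by (simp add: cong_def mod_simps)
    moreover have "j' = j mod m" if "[?k = j' + 1] (mod m)"
    proof -
      from that have "[j + 1 = j' + 1] (mod m)"
        by (simp add: cong_def)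
      then have "[j = j'] (mod m)"
        by (simp only: cong_add_rcancel_nat)
      with \<open>j' < m\<close> show ?thesis
        by (simp add: cong_def)
    qed
    \<comment> \<open>The only vertical neighbour of an outer row is the middle row.\<close>
    ultimately show ?thesis
      using v that(1) by (auto simp: parcs_path_cycle)
  qed
  show ?thesis
  proof
    fix j
    show "f (0, j mod m) \<noteq> 0 \<or> f (0, (j + 1) mod m) \<noteq> 0"
      "f (1, j mod m) \<noteq> 0 \<or> f (1, (j + 1) mod m) \<noteq> 0"
      "f (2, j mod m) \<noteq> 0 \<or> f (2, (j + 1) mod m) \<noteq> 0"
      by (rule indep, rule row, simp)+
    show "f (0, j mod m) \<noteq> 0 \<or> f (1, j mod m) \<noteq> 0" "f (1, j mod m) \<noteq> 0 \<or> f (2, j mod m) \<noteq> 0"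
      using indep[OF col[of 0 j]] indep[OF col[of 1 j]] by (simp_all add: numeral_2_eq_2)
  qed (use dom in auto)
qed

lemma weight_path_cycle:
  "weight (path_graph 3 \<box> cycle_graph m) f = (\<Sum>j<m. f (0, j) + f (1, j) + f (2, j))"
proof -
  have "weight (path_graph 3 \<box> cycle_graph m) f = (\<Sum>i<3. \<Sum>j<m. f (i, j))"
    by (simp add: weight_def pverts_path_cycle sum.cartesian_product)
  also have "\<dots> = (\<Sum>j<m. \<Sum>i<3. f (i, j))"
    by (rule sum.swap)
  finally show ?thesis
    by (simp add: numeral_3_eq_3 numeral_2_eq_2)
qed

lemma weight_ge:
  assumes "oirdf (path_graph 3 \<box> cycle_graph m) f" "m > 0"
  shows "weight (path_graph 3 \<box> cycle_graph m) f \<ge> (if even m then 2 * m else 2 * m + 1)"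
proof -
  interpret oird_columns "\<lambda>j. f (0, j mod m)" "\<lambda>j. f (1, j mod m)" "\<lambda>j. f (2, j mod m)" m
    by (rule oird_columns_of_oirdf[OF assms])
  have "weight (path_graph 3 \<box> cycle_graph m) f = (\<Sum>j<m. w j)"
    unfolding weight_path_cycle w_def by (rule sum.cong) simp_all
  with sum_w_ge even_if_tight assms(2) show ?thesis
    by force
qed

section \<open>The upper bound\<close>

definition alternating_oirdf :: "nat \<Rightarrow> nat \<times> nat \<Rightarrow> nat" where
  "alternating_oirdf m = (\<lambda>(i, j).
     if odd m \<and> j = m - 1 then 1
     else if even j then (if i = 1 then 2 else 0)
     else (if i = 1 then 0 else 1))"

lemma oirdf_alternating:
  assumes "m \<ge> 3"
  shows "oirdf (path_graph 3 \<box> cycle_graph m) (alternating_oirdf m)"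
proof -
  let ?G = "path_graph 3 \<box> cycle_graph m"
  let ?f = "alternating_oirdf m"
  have zero: "?f (i, j) = 0 \<longleftrightarrow> \<not> (odd m \<and> j = m - 1) \<and> (i = 1 \<longleftrightarrow> odd j)" for i j
    by (simp add: alternating_oirdf_def)
  have "\<exists>v\<in>pverts ?G. ((i, j), v) \<in> parcs ?G \<and> ?f v = 2"
    if "i < 3" "j < m" "?f (i, j) = 0" for i j
  proof (cases "i = 1")
    case True
    with that zero have "odd j" by blast
    \<comment> \<open>The column to the left is \<open>(0,2,0)\<close>: it is even, reached without
      wrapping, and not the closing column.\<close>
    then have "j = (j - 1) + 1" "even (j - 1)" "j - 1 \<noteq> m - 1"
      using \<open>j < m\<close> by (auto elim: oddE)
    with that True have "((i, j), (1, j - 1)) \<in> parcs ?G" "?f (1, j - 1) = 2"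
      by (auto simp: parcs_path_cycle alternating_oirdf_def)
    with that show ?thesis
      by (intro bexI[of _ "(1, j - 1)"]) (auto simp: pverts_path_cycle)
  next
    case False
    with that have "?f (1, j) = 2" "((i, j), (1, j)) \<in> parcs ?G"
      by (auto simp: parcs_path_cycle alternating_oirdf_def split: if_splits)
    with that show ?thesis
      by (intro bexI[of _ "(1, j)"]) (auto simp: pverts_path_cycle)
  qed
  moreover have "((i, j), (i', j')) \<notin> parcs ?G"
    if "?f (i, j) = 0" "?f (i', j') = 0" for i j i' j'
  proof
    assume arc: "((i, j), (i', j')) \<in> parcs ?G"
    \<comment> \<open>A horizontal step keeps the parity of the column only when wrapping from
      \<open>m - 1\<close> to 0 with \<open>m\<close> odd, and then column \<open>m - 1\<close> is
      all ones.\<close>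
    have no_succ: "\<not> [l = k + 1] (mod m)"
      if "k < m" "l < m" "odd k \<longleftrightarrow> odd l" "\<not> (odd m \<and> k = m - 1)" for k l
    proof
      assume "[l = k + 1] (mod m)"
      with that(2) have "l = (k + 1) mod m"
        by (simp add: cong_def)
      with that show False
        by (cases "k + 1 = m") auto
    qed
    show False
      using arc that no_succ[of j j'] no_succ[of j' j] unfolding zero parcs_path_cycle by auto
  qed
  ultimately show ?thesis
    unfolding oirdf_def independent_set_def
    by (auto simp: pverts_path_cycle alternating_oirdf_def)
qed

lemma weight_alternating:
  assumes "m > 0"
  shows "weight (path_graph 3 \<box> cycle_graph m) (alternating_oirdf m) =
    (if even m then 2 * m else 2 * m + 1)"
proof -
  have "weight (path_graph 3 \<box> cycle_graph m) (alternating_oirdf m) =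
      (\<Sum>j<m. 2 + (if j = m - 1 then of_bool (odd m) else 0))"
    unfolding weight_path_cycle by (rule sum.cong) (auto simp: alternating_oirdf_def)
  also have "\<dots> = 2 * m + of_bool (odd m)"
    using assms by (simp only: sum.distrib) simp
  finally show ?thesis
    by simp
qed

theorem theorem3:
  fixes m :: nat
  assumes "m \<ge> 3"
  shows "\<gamma>\<^sub>o\<^sub>i\<^sub>R (path_graph 3 \<box> cycle_graph m) = (if even m then 2 * m else 2 * m + 1)"
proof (rule antisym)
  from assms have "m > 0" by simp
  then show "\<gamma>\<^sub>o\<^sub>i\<^sub>R (path_graph 3 \<box> cycle_graph m) \<le> (if even m then 2 * m else 2 * m + 1)"
    using oir_domination_number_le[OF oirdf_alternating[OF assms]] weight_alternating by metis
  show "(if even m then 2 * m else 2 * m + 1) \<le> \<gamma>\<^sub>o\<^sub>i\<^sub>R (path_graph 3 \<box> cycle_graph m)"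
    using oir_domination_number_attained weight_ge \<open>m > 0\<close> by metis
qed

end
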